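(* The Maltsev condition $\Sigma_G$ does not have the local-global property for idempotent algebras for each of the following permutation groups $G$: (1) the symmetric group $G = \mathrm{Sym}(n)$ for any $n \geq 3$; (2) the dihedral groups $G = D_n \leq \mathrm{Sym}(n)$ for all odd $n>1$; (3) the alternating groups $G = A_n \leq \mathrm{Sym}(n)$ for all $n \geq 4$; (4) the block-symmetric group $G= \mathrm{Sym}(n) \times \mathrm{Sym}(n+1)$ for every $n \geq 2$.
   Context: An algebra $\mathbf{A} = (A,(f_i)_{i\in I})$ is a non-empty set $A$ with a list of finitary operations. It is idempotent if $f_i(x,\ldots,x)=x$ for all basic operations $f_i$ and all $x\in A$. $\mathsf{Clo}(\mathbf A)$ is the set of term operations of $\mathbf A$, i.e. all operations obtained by composing basic operations and projections. For a permutation group $G \leq \mathrm{Sym}(X)$ on a finite set $X$ and $t\colon A^X\to A$, write $t^\pi((x_i)_{i\in X}) = t((x_{\pi(i)})_{i\in X})$. $\Sigma_G$ is the set of identities $t\approx t^\pi$, $\pi\in G$, in one $X$-ary function symbol $t$. For $F\subseteq A^X$, $\mathbf A$ satisfies $\Sigma_G$ on $F$ if there is an $X$-ary $t\in\mathsf{Clo}(\mathbf A)$ with $t(\overline x)=t^\pi(\overline x)$ for all $\pi\in G$ and all $\overline x\in F$. For $k\ge1$, $\Sigma_G$ has the $k$-local-global property for idempotent algebras if every idempotent algebra $\mathbf A$ such that $|A|^{|X|}\geq k$ and $\mathbf A$ satisfies $\Sigma_G$ on all $k$-element sets $F\subseteq A^{X}$ satisfies $\Sigma_G$ on every finite subset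 of $A^{X}$. It has the local-global property for idempotent algebras if it has the $k$-local-global property for idempotent algebras for some $k\geq 1$. $D_n\leq \mathrm{Sym}(n)$ is the dihedral group of degree $n$: the symmetry group of a regular $n$-gon acting on its vertices $\{1,\dots,n\}$, generated by the rotation $(1,2,\dots,n)$ and the reflection $i\mapsto n+1-i$. $\mathrm{Sym}(n)\times\mathrm{Sym}(n+1)$ acts naturally on the disjoint union of an $n$-element set and an $(n+1)$-element set (total degree $2n+1$). *)

theory Defs
  imports "HOL-Algebra.Sym_Groups" "HOL-Algebra.Generated_Groups" "HOL-Library.FuncSet"
begin

(* Universal algebras.  A basic operation is a pair (n, f) of its arity n and a function f on lists,
   of which only the values on lists of length n over the carrier are relevant.  A family
   (f_i)_{i : I} is represented by the set of its members: neither idempotence nor the term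
   operations depend on the indexing. *)

record 'a ualgebra = "'a partial_object" +
  basic_ops :: "(nat \<times> ('a list \<Rightarrow> 'a)) set"

definition ualgebra :: "'a ualgebra \<Rightarrow> bool" where
  "ualgebra A \<longleftrightarrow> carrier A \<noteq> {} \<and>
     (\<forall>(n, f) \<in> basic_ops A. \<forall>xs. set xs \<subseteq> carrier A \<longrightarrow> length xs = n \<longrightarrow> f xs \<in> carrier A)"

definition idempotent :: "'a ualgebra \<Rightarrow> bool" where
  "idempotent A \<longleftrightarrow> (\<forall>(n, f) \<in> basic_ops A. \<forall>x \<in> carrier A. f (replicate n x) = x)"

definition tuples :: "'a ualgebra \<Rightarrow> 'x set \<Rightarrow> ('x \<Rightarrow> 'a) set" where
  "tuples A X = (X \<rightarrow>\<^sub>E carrier A)"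

(* The X-ary term operations.  They are total functions here, of which only the values on
   tuples A X are relevant. *)

inductive_set Clo :: "'a ualgebra \<Rightarrow> 'x set \<Rightarrow> (('x \<Rightarrow> 'a) \<Rightarrow> 'a) set"
  for A :: "'a ualgebra" and X :: "'x set" where
  proj: "i \<in> X \<Longrightarrow> (\<lambda>x. x i) \<in> Clo A X"
| comp: "(n, f) \<in> basic_ops A \<Longrightarrow> length ts = n \<Longrightarrow> \<forall>t \<in> set ts. t \<in> Clo A X \<Longrightarrow>
           (\<lambda>x. f (map (\<lambda>t. t x) ts)) \<in> Clo A X"

(* For p permuting X, composition with p maps tuples A X to itself, since p fixes every
   point outside X. *)

definition perm_op :: "(('x \<Rightarrow> 'a) \<Rightarrow> 'a) \<Rightarrow> ('x \<Rightarrow> 'x) \<Rightarrow> ('x \<Rightarrow> 'a) \<Rightarrow> 'a" where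
  "perm_op t p = (\<lambda>x. t (\<lambda>i. x (p i)))"

definition satisfies_Sigma_on ::
    "'a ualgebra \<Rightarrow> 'x set \<Rightarrow> ('x \<Rightarrow> 'x) set \<Rightarrow> ('x \<Rightarrow> 'a) set \<Rightarrow> bool" where
  "satisfies_Sigma_on A X G F \<longleftrightarrow>
     (\<exists>t \<in> Clo A X. \<forall>p \<in> G. \<forall>x \<in> F. t x = perm_op t p x)"

(* The properties below concern all idempotent algebras whose carrier is a subset of the type 'a.
   A counterexample inside any one type, such as nat, refutes them for the class of all algebras.
   The size condition has to treat infinite carriers separately because their card is 0. *)

definition k_local_global_idempotent ::
    "'a itself \<Rightarrow> nat \<Rightarrow> 'x set \<Rightarrow> ('x \<Rightarrow> 'x) set \<Rightarrow> bool" where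
  "k_local_global_idempotent TYPE('a) k X G \<longleftrightarrow>
     (\<forall>A :: 'a ualgebra. ualgebra A \<longrightarrow> idempotent A \<longrightarrow>
        (infinite (carrier A) \<or> k \<le> card (carrier A) ^ card X) \<longrightarrow>
        (\<forall>F \<subseteq> tuples A X. finite F \<longrightarrow> card F = k \<longrightarrow> satisfies_Sigma_on A X G F) \<longrightarrow>
        (\<forall>F \<subseteq> tuples A X. finite F \<longrightarrow> satisfies_Sigma_on A X G F))"

definition local_global_idempotent ::
    "'a itself \<Rightarrow> 'x set \<Rightarrow> ('x \<Rightarrow> 'x) set \<Rightarrow> bool" where
  "local_global_idempotent TYPE('a) X G \<longleftrightarrow>
     (\<exists>k \<ge> 1. k_local_global_idempotent TYPE('a) k X G)"

definition rotation :: "nat \<Rightarrow> nat \<Rightarrow> nat" where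
  "rotation n = cycle_of_list [1..<Suc n]"

definition reflection :: "nat \<Rightarrow> nat \<Rightarrow> nat" where
  "reflection n = (\<lambda>i. if i \<in> {1..n} then n + 1 - i else i)"

definition dihedral :: "nat \<Rightarrow> (nat \<Rightarrow> nat) set" where
  "dihedral n = generate (sym_group n) {rotation n, reflection n}"

definition block_symmetric :: "nat \<Rightarrow> nat \<Rightarrow> (nat + nat \<Rightarrow> nat + nat) set" where
  "block_symmetric m n =
     (\<lambda>(p, q). map_sum p q) ` carrier (sym_group m \<times>\<times> sym_group n)"

lemma reflection_permutes: "reflection n permutes {1..n}"
  by (rule bij_imp_permutes)
     (auto simp: reflection_def intro!: bij_betw_byWitness[where f' = "\<lambda>i. n + 1 - i"])

lemma rotation_permutes: "rotation n permutes {1..n}"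
proof -
  have "set [1..<Suc n] = {1..n}" by auto
  then show ?thesis unfolding rotation_def by (metis cycle_permutes)
qed

lemma dihedral_subgroup: "subgroup (dihedral n) (sym_group n)"
  unfolding dihedral_def
  by (rule group.generate_is_subgroup[OF sym_group_is_group])
     (use reflection_permutes rotation_permutes in \<open>auto simp: sym_group_carrier\<close>)

lemma block_symmetric_permutes:
  assumes "r \<in> block_symmetric m n"
  shows "r permutes {1..m} <+> {1..n}"
proof -
  obtain p q where r: "r = map_sum p q" and p: "p permutes {1..m}" and q: "q permutes {1..n}"
    using assms by (auto simp: block_symmetric_def DirProd_def sym_group_carrier)
  have "r (map_sum (inv' p) (inv' q) x) = x" and "map_sum (inv' p) (inv' q) (r x) = x" for x
    unfolding r by (cases x; simp add: permutes_inverses[OF p] permutes_inverses[OF q])+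
  then have "\<exists>!x. r x = y" for y by metis
  moreover have "r x = x" if "x \<notin> {1..m} <+> {1..n}" for x
  proof (cases x)
    case (Inl i)
    then have "i \<notin> {1..m}" using that by blast
    then show ?thesis using permutes_not_in[OF p, of i] by (simp add: r Inl)
  next
    case (Inr i)
    then have "i \<notin> {1..n}" using that by blast
    then show ?thesis using permutes_not_in[OF q, of i] by (simp add: r Inr)
  qed
  ultimately show ?thesis by (simp add: permutes_def)
qed

end

theory Submission
  imports Defs "HOL-Library.Countable" "HOL-Number_Theory.Cong"
begin

text \<open>
  Suppose that some \<open>\<gamma>\<close> in \<open>G\<close> has exactly one fixed point \<open>w\<close>, that \<open>G\<close> moves \<open>w\<close>, and that all
  other cycles of \<open>\<gamma>\<close> have a length divisible by \<open>N \<ge> 2\<close>, so that \<open>card X\<close> is 1 modulo \<open>N\<close>. Then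
  \<open>\<Sigma>\<^sub>G\<close> does not have the local-global property, for the following reason.

  The algebra consists of \<open>m\<close> copies of the disjoint union of \<open>X\<close> (vertices) and \<open>\<int>/N\<close> (residues),
  and has one \<open>X\<close>-ary basic operation \<open>f\<^sub>l\<close> for each copy \<open>l\<close>. On arguments from different copies all
  operations take the same constant value. Inside a copy, residues are added up;
  this is idempotent because \<open>card X\<close> is 1 modulo \<open>N\<close>. If there are vertices among the
  arguments, then the residues are ignored: a common value of all vertices is returned, and vertices
  that differ yield a residue of their copy. That residue is 0, except that in copy \<open>l\<close> it
  increases by 1 when \<open>\<gamma>\<close> is applied to all vertices. Such a choice is possible since among
  different vertices some vertex is not fixed by \<open>\<gamma>\<close>.

  Locally: \<open>f\<^sub>l\<close> is invariant under all permutations of its arguments except on tuples inside copy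
  \<open>l\<close>. Fewer than \<open>m\<close> tuples miss some copy \<open>l\<close>, and there \<open>f\<^sub>l\<close> is a \<open>G\<close>-invariant term
  (\<open>locally_symmetric\<close>).

  Globally: consider in each copy \<open>i\<close> the tuple listing all vertices, and its images under \<open>G\<close>. On
  these tuples a term is either a projection, in all copies, or it takes residues as values, in all
  copies. In the second case let \<open>d\<^sub>i\<close> be its change in copy \<open>i\<close> under \<open>\<gamma>\<close>. For \<open>f\<^sub>l\<close> itself \<open>d\<close> is
  the \<open>l\<close>-th unit vector, and adding up \<open>card X\<close> terms keeps the sum of all \<open>d\<^sub>i\<close> equal to 1 modulo \<open>N\<close>
  (\<open>vertex_like_or_residue_like\<close>). So some \<open>d\<^sub>i\<close> is nonzero and the term is not invariant;
  a projection is not invariant either, as \<open>G\<close> has no fixed point.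

  It remains to find \<open>\<gamma>\<close> in each group: an \<open>(n-1)\<close>-cycle in \<open>Sym(n)\<close>, a reflection in \<open>D\<^sub>n\<close> for odd
  \<open>n\<close>, the square of an \<open>(n-1)\<close>-cycle in \<open>A\<^sub>n\<close>, and an \<open>n\<close>-cycle on both blocks in
  \<open>Sym(n) \<times> Sym(n+1)\<close>.
\<close>

section \<open>Vertices and residues\<close>

datatype 'x point = Vertex (copy: nat) 'x | Residue (copy: nat) (residue: int)

instance point :: (countable) countable by countable_datatype

fun vertices :: "'x point list \<Rightarrow> 'x list" where
  "vertices [] = []"
| "vertices (Vertex i a # zs) = a # vertices zs"
| "vertices (Residue i r # zs) = vertices zs"

lemma set_vertices: "set (vertices zs) = {a. \<exists>i. Vertex i a \<in> set zs}"
  by (induction zs rule: vertices.induct) auto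

lemma vertices_map_Vertex:
  assumes "\<And>s. s \<in> set ss \<Longrightarrow> if P s then f s = Vertex i (g s) else \<exists>r. f s = Residue i r"
  shows "vertices (map f ss) = map g (filter P ss)"
  using assms
proof (induction ss)
  case (Cons s ss)
  have "if P s then f s = Vertex i (g s) else \<exists>r. f s = Residue i r"
    using Cons.prems[of s] by simp
  moreover have "vertices (map f ss) = map g (filter P ss)"
    using Cons.prems by (intro Cons.IH) auto
  ultimately show ?case by (auto split: if_splits)
qed simp

section \<open>Permutations with a unique fixed point and the twisted algebra\<close>

text \<open>
  The function \<open>\<nu>\<close> numbers each cycle of \<open>\<gamma>\<close> other than \<open>{w}\<close> consecutively modulo \<open>N\<close>. Its existence
  says that the lengths of these cycles are multiples of \<open>N\<close>; together with \<open>N \<ge> 2\<close> it forces \<open>w\<close>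
  to be the only fixed point of \<open>\<gamma>\<close> in \<open>X\<close>.
\<close>

locale unique_fixed_point =
  fixes X :: "'x::countable set" and G :: "('x \<Rightarrow> 'x) set"
    and \<gamma> :: "'x \<Rightarrow> 'x" and w :: 'x and \<nu> :: "'x \<Rightarrow> int" and N :: int
  assumes finite_X: "finite X"
    and permutes_X: "h \<in> G \<Longrightarrow> h permutes X"
    and id_in_G: "id \<in> G" and \<gamma>_in_G: "\<gamma> \<in> G"
    and w_in_X: "w \<in> X" and \<gamma>_w: "\<gamma> w = w"
    and w_moved: "\<exists>h \<in> G. h w \<noteq> w"
    and \<nu>_shift: "a \<in> X \<Longrightarrow> a \<noteq> w \<Longrightarrow> [\<nu> (\<gamma> a) = \<nu> a + 1] (mod N)"
    and N_ge_2: "N \<ge> 2"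
    and card_X_cong: "[int (card X) = 1] (mod N)"
begin

text \<open>
  The case distinction is phrased such that each case is stable under permuting the arguments and
  under applying one injection to all vertices. Only the \<open>\<nu>\<close>-value of the first vertex other than \<open>w\<close>
  depends on the order. The value \<open>Residue 0 0\<close> on arguments from several copies is an arbitrary
  constant, harmless for idempotence since such arguments are not all equal.
\<close>

definition twisted :: "nat \<Rightarrow> 'x point list \<Rightarrow> 'x point" where
  "twisted l zs = (let i = copy (hd zs); vs = vertices zs in
     if \<exists>z \<in> set zs. copy z \<noteq> i then Residue 0 0
     else if vs = [] then Residue i ((\<Sum>z \<leftarrow> zs. residue z) mod N)
     else if \<exists>c. set vs = {c} then Vertex i (hd vs)
     else Residue i (if i = l then \<nu> (hd (filter (\<lambda>a. a \<noteq> w) vs)) mod N else 0))"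

definition points :: "nat \<Rightarrow> 'x point set" where
  "points m = (\<Union>i<m. Vertex i ` X \<union> Residue i ` {0..<N})"

text \<open>
  The points are encoded as natural numbers because the algebra has to live inside \<^typ>\<open>nat\<close>.
\<close>

definition twisted_algebra :: "nat \<Rightarrow> nat ualgebra" where
  "twisted_algebra m = \<lparr>carrier = to_nat ` points m,
     basic_ops = (\<lambda>l. (card X, \<lambda>xs. to_nat (twisted l (map from_nat xs)))) ` {..<m}\<rparr>"

lemma card_X_pos: "card X > 0"
  using finite_X w_in_X by (auto simp: card_gt_0_iff)

lemma copy_less: "z \<in> points m \<Longrightarrow> copy z < m"
  by (auto simp: points_def)

lemma Vertex_in_points [simp]: "Vertex i a \<in> points m \<longleftrightarrow> i < m \<and> a \<in> X"
  by (auto simp: points_def)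

lemma Residue_in_points [simp]: "Residue i (r mod N) \<in> points m \<longleftrightarrow> i < m"
  using N_ge_2 by (auto simp: points_def image_iff)

lemma Residue_0_in_points [simp]: "Residue i 0 \<in> points m \<longleftrightarrow> i < m"
  using Residue_in_points[of i 0] by simp

lemma twisted_in_points:
  assumes "set zs \<subseteq> points m" "zs \<noteq> []" "l < m"
  shows "twisted l zs \<in> points m"
proof -
  have "copy (hd zs) < m" using assms hd_in_set[OF assms(2)] copy_less by blast
  moreover have "hd (vertices zs) \<in> X" if "vertices zs \<noteq> []"
    using hd_in_set[OF that] assms(1) by (auto simp: set_vertices points_def)
  ultimately show ?thesis using assms(3) by (auto simp: twisted_def Let_def)
qed

lemma finite_points: "finite (points m)"
  using finite_X by (auto simp: points_def)

lemma ualgebra_twisted: 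
  assumes "m > 0" shows "ualgebra (twisted_algebra m)"
proof -
  have "points m \<noteq> {}" using assms w_in_X Vertex_in_points[of 0 w m] by blast
  moreover have "twisted l (map from_nat xs) \<in> points m"
    if "set xs \<subseteq> to_nat ` points m" "length xs = card X" "l < m" for l xs
    using that card_X_pos by (intro twisted_in_points) auto
  ultimately show ?thesis by (auto simp: ualgebra_def twisted_algebra_def)
qed

lemma twisted_replicate:
  assumes "z \<in> points m" "[int n = 1] (mod N)" "n > 0"
  shows "twisted l (replicate n z) = z"
proof (cases z)
  case (Vertex i a)
  have "vertices (replicate n z) = replicate n a"
    by (induction n) (auto simp: Vertex)
  then show ?thesis using assms(3) Vertex by (simp add: twisted_def)
next
  case (Residue i r)
  have "vertices (replicate n z) = []" by (induction n) (auto simp: Residue)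
  moreover have "(int n * r) mod N = r"
  proof -
    have "[int n * r = 1 * r] (mod N)" by (intro cong_mult assms) simp
    moreover have "0 \<le> r" "r < N" using assms(1) Residue by (auto simp: points_def)
    ultimately show ?thesis by (simp add: cong_def)
  qed
  ultimately show ?thesis using assms(3) Residue by (simp add: twisted_def sum_list_replicate)
qed

lemma idempotent_twisted: "idempotent (twisted_algebra m)"
  using card_X_pos card_X_cong
  by (auto simp: idempotent_def twisted_algebra_def twisted_replicate)

text \<open>
  Outside copy \<open>l\<close> the order of the arguments does not matter: sums are commutative, and the first
  vertex is only taken when all vertices agree.
\<close>

lemma twisted_symmetric:
  assumes "mset zs = mset ys" "zs \<noteq> []" "copy (hd zs) \<noteq> l"
  shows "twisted l zs = twisted l ys"
proof -
  have set_eq: "set zs = set ys" using assms(1) by (rule mset_eq_setD)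
  have ys: "ys \<noteq> []" using assms by auto
  have set_v: "set (vertices zs) = set (vertices ys)" by (simp add: set_vertices set_eq)
  then have nil: "vertices zs = [] \<longleftrightarrow> vertices ys = []" by (metis set_empty)
  have sum: "(\<Sum>z \<leftarrow> zs. residue z) = (\<Sum>z \<leftarrow> ys. residue z)"
    using assms(1) by (metis mset_map sum_mset_sum_list)
  have hd: "hd (vertices zs) = hd (vertices ys)" if "set (vertices ys) = {c}" for c
    using that set_v nil hd_in_set by (metis insert_not_empty set_empty singletonD)
  show ?thesis
  proof (cases "\<exists>z \<in> set zs. copy z \<noteq> copy (hd zs)")
    case True
    then have "\<exists>z \<in> set ys. copy z \<noteq> copy (hd ys)" using set_eq assms(2) by (metis hd_in_set)
    with True show ?thesis by (simp add: twisted_def)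
  next
    case False
    then have same: "copy (hd ys) = copy (hd zs)" using set_eq ys by simp
    show ?thesis using False assms(3) hd unfolding twisted_def Let_def same set_eq set_v nil sum
      by auto
  qed
qed

section \<open>Symmetric terms on small sets\<close>

definition enum_X :: "'x list" where
  "enum_X = (SOME xs. set xs = X \<and> distinct xs)"

lemma enum_X: "set enum_X = X" "distinct enum_X"
proof -
  have "set enum_X = X \<and> distinct enum_X" 
    unfolding enum_X_def using finite_distinct_list[OF finite_X] by (rule someI_ex)
  then show "set enum_X = X" "distinct enum_X" by auto
qed

lemma length_enum_X: "length enum_X = card X"
  using distinct_card[OF enum_X(2)] by (simp add: enum_X)

lemma mset_map_permuted:
  assumes "h permutes X"
  shows "mset (map (\<lambda>a. f (h a)) enum_X) = mset (map f enum_X)"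
proof -
  have "image_mset h (mset enum_X) = mset enum_X"
    using permutes_image[OF assms] permutes_inj[OF assms]
      by (simp add: mset_set_set[OF enum_X(2), symmetric] enum_X image_mset_mset_set inj_on_subset)
  then have "image_mset f (image_mset h (mset enum_X)) = image_mset f (mset enum_X)" by simp
  then show ?thesis by (simp add: multiset.map_comp comp_def)
qed

text \<open>
  A tuple lies inside at most one copy, which its first entry reveals. By the pigeonhole principle
  fewer than \<open>m\<close> tuples leave some copy \<open>l\<close> unused, and the twist of the \<open>l\<close>-th operation is not
  seen by any of them.
\<close>

lemma locally_symmetric:
  assumes "F \<subseteq> tuples (twisted_algebra m) X" "finite F" "card F < m"
  shows "satisfies_Sigma_on (twisted_algebra m) X G F"
proof -
  have ne: "enum_X \<noteq> []" using enum_X w_in_X by auto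
  let ?used = "(\<lambda>x. copy (from_nat (x (hd enum_X)) :: 'x point)) ` F"
  have "card ?used < card {..<m}" using le_less_trans[OF card_image_le[OF assms(2)] assms(3)] by simp
  then obtain l where l: "l < m" "l \<notin> ?used"
    by (metis assms(2) card_mono finite_imageI lessThan_iff not_less subsetI)
  define t where "t = (\<lambda>x. to_nat (twisted l (map from_nat
      (map (\<lambda>t. t x) (map (\<lambda>a (x :: 'x \<Rightarrow> nat). x a) enum_X)))))"
  have "t \<in> Clo (twisted_algebra m) X" unfolding t_def
    by (rule Clo.comp[where n = "card X"])
       (use l(1) in \<open>auto simp: twisted_algebra_def length_enum_X enum_X intro: Clo.proj\<close>)
  moreover have "t x = perm_op t h x" if "h \<in> G" "x \<in> F" for h x
  proof -
    have "twisted l (map (\<lambda>a. from_nat (x a)) enum_X) 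
        = twisted l (map (\<lambda>a. from_nat (x (h a))) enum_X)"
      using ne l(2) that
      by (intro twisted_symmetric mset_map_permuted[symmetric] permutes_X) (auto simp: hd_map)
    then show ?thesis by (simp add: t_def perm_op_def comp_def)
  qed
  ultimately show ?thesis by (auto simp: satisfies_Sigma_on_def)
qed

section \<open>No symmetric term on all vertex tuples\<close>

text \<open>
  For \<open>h = id\<close> this is the tuple listing all vertices of copy \<open>i\<close>; permuting its
  arguments by \<open>h\<close> amounts to applying \<open>h\<close> to its entries.
\<close>

definition vertex_tuple :: "nat \<Rightarrow> ('x \<Rightarrow> 'x) \<Rightarrow> 'x \<Rightarrow> nat" where
  "vertex_tuple i h = (\<lambda>a. restrict (\<lambda>a. to_nat (Vertex i a)) X (h a))"

definition value_at :: "(('x \<Rightarrow> nat) \<Rightarrow> nat) \<Rightarrow> nat \<Rightarrow> ('x \<Rightarrow> 'x) \<Rightarrow> 'x point" where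
  "value_at t i h = from_nat (t (vertex_tuple i h))"

definition vertex_like :: "nat \<Rightarrow> (('x \<Rightarrow> nat) \<Rightarrow> nat) \<Rightarrow> 'x \<Rightarrow> bool" where
  "vertex_like m t a \<longleftrightarrow> a \<in> X \<and> (\<forall>i<m. \<forall>h\<in>G. value_at t i h = Vertex i (h a))"

text \<open>
  The congruence is the invariant of the whole argument: a term that is symmetric in all copies
  would make the sum 0.
\<close>

definition residue_like :: "nat \<Rightarrow> (('x \<Rightarrow> nat) \<Rightarrow> nat) \<Rightarrow> bool" where
  "residue_like m t \<longleftrightarrow>
     (\<forall>i<m. \<forall>h\<in>G. \<exists>r. value_at t i h = Residue i r) \<and>
     [(\<Sum>i<m. residue (value_at t i \<gamma>) - residue (value_at t i id)) = 1] (mod N)"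

text \<open>
  The type of a subterm is the same in every copy and on every image of the vertex tuple, hence
  so is the case that \<open>twisted\<close> chooses at the top of a composite term. If all subterms are
  residue-like, then the invariant of the composite is a sum of \<open>card X\<close> ones; if
  vertex-like subterms agree, the composite is vertex-like; if they differ, only copy \<open>l\<close> reacts to
  \<open>\<gamma>\<close>, by exactly 1.
\<close>

lemma vertex_like_or_residue_like:
  assumes "t \<in> Clo (twisted_algebra m) X"
  shows "(\<exists>a. vertex_like m t a) \<or> residue_like m t"
  using assms
proof induction
  case (proj a)
  then have "vertex_like m (\<lambda>x. x a) a"
    using permutes_in_image[OF permutes_X]
    by (auto simp: vertex_like_def value_at_def vertex_tuple_def)
  then show ?case by blast
next
  case (comp n f ts)
  obtain l where l: "l < m" and n: "n = card X"
    and f: "f = (\<lambda>xs. to_nat (twisted l (map from_nat xs)))"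
    using comp.hyps by (auto simp: twisted_algebra_def)
  let ?t = "\<lambda>x. f (map (\<lambda>t. t x) ts)"
  have val: "value_at ?t i h = twisted l (map (\<lambda>s. value_at s i h) ts)" for i h
    by (simp add: value_at_def f comp_def)
  define V where "V s \<longleftrightarrow> (\<exists>a. vertex_like m s a)" for s
  define av where "av s = (SOME a. vertex_like m s a)" for s
  define as where "as = map av (filter V ts)"
  have ts_ne: "ts \<noteq> []" using comp.hyps n card_X_pos by auto
  have V: "vertex_like m s (av s)" if "V s" for s
    using that unfolding V_def av_def by (rule someI_ex)
  have R: "residue_like m s" if "s \<in> set ts" "\<not> V s" for s
    using comp.hyps comp.IH that by (auto simp: V_def)
  have as_X: "set as \<subseteq> X" using V by (auto simp: as_def vertex_like_def)
  have cases: "if V s then value_at s i h = Vertex i (h (av s)) else \<exists>r. value_at s i h = Residue i r"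
    if "s \<in> set ts" "i < m" "h \<in> G" for s i h
    using V[of s] R[of s] that by (auto simp: vertex_like_def residue_like_def)
  have vert: "vertices (map (\<lambda>s. value_at s i h) ts) = map h as" if "i < m" "h \<in> G" for i h
    using vertices_map_Vertex[of ts V "\<lambda>s. value_at s i h" i "\<lambda>s. h (av s)"] cases that
    by (simp add: as_def comp_def)
  have cop: "copy (value_at s i h) = i" if "s \<in> set ts" "i < m" "h \<in> G" for s i h
    using cases[OF that] by (auto split: if_splits)
  have eval: "value_at ?t i h = 
      (if as = [] then Residue i ((\<Sum>s \<leftarrow> ts. residue (value_at s i h)) mod N)
       else if \<exists>c. set as = {c} then Vertex i (h (hd as))
       else Residue i (if i = l then \<nu> (hd (filter (\<lambda>a. a \<noteq> w) (map h as))) mod N else 0))"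
    if "i < m" "h \<in> G" for i h
  proof -
    have "inj h" using permutes_inj permutes_X that(2) by blast
    have "(\<exists>c. h ` set as = {c}) \<longleftrightarrow> (\<exists>c. set as = {c})"
    proof
      assume "\<exists>c. h ` set as = {c}"
      then obtain c where c: "h ` set as = {c}" by blast
      then obtain a where "a \<in> set as" "h a = c" by blast
      then have "set as = {a}" using c \<open>inj h\<close> by (auto simp: inj_def)
      then show "\<exists>c. set as = {c}" by blast
    qed auto
    moreover have "copy (hd (map (\<lambda>s. value_at s i h) ts)) = i"
      using ts_ne cop that by (simp add: hd_map)
    ultimately show ?thesis using cop that
      by (simp add: val twisted_def Let_def vert hd_map comp_def)
  qed
  consider "as = []" | c where "set as = {c}" | "as \<noteq> []" "\<nexists>c. set as = {c}" by blast
  then show ?case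
  proof cases
    case 1
    have noV: "\<not> V s" if "s \<in> set ts" for s using 1 that by (auto simp: as_def filter_empty_conv)
    have "[(\<Sum>i<m. residue (value_at ?t i \<gamma>) - residue (value_at ?t i id)) = 
        (\<Sum>i<m. (\<Sum>s \<leftarrow> ts. residue (value_at s i \<gamma>)) - (\<Sum>s \<leftarrow> ts. residue (value_at s i id)))] (mod N)"
      using id_in_G \<gamma>_in_G by (intro cong_sum) (simp add: eval 1 cong_def mod_diff_eq)
    also have "(\<Sum>i<m. (\<Sum>s \<leftarrow> ts. residue (value_at s i \<gamma>)) - (\<Sum>s \<leftarrow> ts. residue (value_at s i id)))
       = (\<Sum>s \<leftarrow> ts. \<Sum>i<m. residue (value_at s i \<gamma>) - residue (value_at s i id))"
      by (induction ts) (simp_all add: sum.distrib sum_subtractf)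
    also have "[(\<Sum>s \<leftarrow> ts. \<Sum>i<m. residue (value_at s i \<gamma>) - residue (value_at s i id))
        = (\<Sum>s \<leftarrow> ts. 1)] (mod N)"
    proof -
      have "\<forall>s \<in> set ts. [(\<Sum>i<m. residue (value_at s i \<gamma>) - residue (value_at s i id)) = 1] (mod N)"
        using R noV by (auto simp: residue_like_def)
      then show ?thesis by (induction ts) (auto intro: cong_add)
    qed
    also have "(\<Sum>s \<leftarrow> ts. 1) = int (card X)"
      using comp.hyps n by (simp add: sum_list_triv)
    also note card_X_cong
    finally have "[(\<Sum>i<m. residue (value_at ?t i \<gamma>) - residue (value_at ?t i id)) = 1] (mod N)" .
    moreover have "\<forall>i<m. \<forall>h\<in>G. \<exists>r. value_at ?t i h = Residue i r" by (simp add: eval 1)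
    ultimately have "residue_like m ?t" unfolding residue_like_def by blast
    then show ?thesis by blast
  next
    case (2 c)
    then have "as \<noteq> []" by auto
    then have "hd as = c" using 2 hd_in_set by blast
    with \<open>as \<noteq> []\<close> have "vertex_like m ?t c" using 2 as_X by (auto simp: vertex_like_def eval)
    then show ?thesis by blast
  next
    case 3
    obtain a where a: "a \<in> set as" "a \<noteq> w"
      using 3 by (metis all_not_in_conv insertI1 is_singletonI' is_singleton_def set_empty)
    define b where "b = hd (filter (\<lambda>a. a \<noteq> w) as)"
    have "filter (\<lambda>a. a \<noteq> w) as \<noteq> []" using a by (auto simp: filter_empty_conv)
    then have "b \<in> set (filter (\<lambda>a. a \<noteq> w) as)" unfolding b_def by (rule hd_in_set)
    then have b: "b \<in> X" "b \<noteq> w" using as_X by auto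
    \<comment> \<open>Since \<open>\<gamma>\<close> fixes \<open>w\<close>, the first vertex other than \<open>w\<close> stays at the same position.\<close>
    have "\<gamma> a = w \<longleftrightarrow> a = w" for a
      using permutes_inj[OF permutes_X[OF \<gamma>_in_G]] \<gamma>_w by (metis injD)
    then have "hd (filter (\<lambda>a. a \<noteq> w) (map \<gamma> as)) = \<gamma> b"
      using \<open>filter (\<lambda>a. a \<noteq> w) as \<noteq> []\<close> by (simp add: filter_map comp_def hd_map b_def)
    then have "(\<Sum>i<m. residue (value_at ?t i \<gamma>) - residue (value_at ?t i id))
      = (\<Sum>i<m. if i = l then \<nu> (\<gamma> b) mod N - \<nu> b mod N else 0)"
      using 3 id_in_G \<gamma>_in_G by (intro sum.cong) (auto simp: eval b_def)
    also have "\<dots> = \<nu> (\<gamma> b) mod N - \<nu> b mod N" using l by simp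
    also have "[\<dots> = \<nu> (\<gamma> b) - \<nu> b] (mod N)" by (simp add: cong_def mod_diff_eq)
    also have "[\<nu> (\<gamma> b) - \<nu> b = \<nu> b + 1 - \<nu> b] (mod N)" using b by (intro cong_diff \<nu>_shift) auto
    finally have "[(\<Sum>i<m. residue (value_at ?t i \<gamma>) - residue (value_at ?t i id)) = 1] (mod N)" by simp
    moreover have "\<forall>i<m. \<forall>h\<in>G. \<exists>r. value_at ?t i h = Residue i r"
      using 3 by (simp add: eval)
    ultimately have "residue_like m ?t" unfolding residue_like_def by blast
    then show ?thesis by blast
  qed
qed

lemma not_globally_symmetric:
  assumes "m > 0"
  shows "\<not> satisfies_Sigma_on (twisted_algebra m) X G ((\<lambda>i. vertex_tuple i id) ` {..<m})"
proof
  assume "satisfies_Sigma_on (twisted_algebra m) X G ((\<lambda>i. vertex_tuple i id) ` {..<m})"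
  then obtain t where t: "t \<in> Clo (twisted_algebra m) X"
    and "\<forall>h\<in>G. \<forall>i<m. t (vertex_tuple i id) = t (vertex_tuple i h)"
    by (auto simp: satisfies_Sigma_on_def perm_op_def vertex_tuple_def)
  then have inv: "value_at t i h = value_at t i id" if "i < m" "h \<in> G" for i h
    using that by (simp add: value_at_def)
  have "\<not> vertex_like m t a" for a
  proof
    assume a: "vertex_like m t a"
    have fixed: "h a = a" if "h \<in> G" for h
      using a inv[of 0 h] assms that id_in_G by (auto simp: vertex_like_def)
    have "a \<in> X" using a by (simp add: vertex_like_def)
    have "a = w"
    proof (rule ccontr)
      assume "a \<noteq> w"
      then have "[\<nu> a = \<nu> a + 1] (mod N)" using \<nu>_shift \<open>a \<in> X\<close> fixed \<gamma>_in_G by metis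
      then show False using N_ge_2 by (simp add: cong_iff_dvd_diff)
    qed
    then show False using fixed w_moved by auto
  qed
  moreover have "\<not> residue_like m t"
    using inv[OF _ \<gamma>_in_G] N_ge_2 by (simp add: residue_like_def cong_def)
  ultimately show False using vertex_like_or_residue_like[OF t] by blast
qed

text \<open>
  One copy more than the size \<open>k\<close> of the local sets suffices.
\<close>

theorem not_local_global_idempotent: "\<not> local_global_idempotent TYPE(nat) X G"
proof
  assume "local_global_idempotent TYPE(nat) X G"
  then obtain k where k: "k_local_global_idempotent TYPE(nat) k X G"
    by (auto simp: local_global_idempotent_def)
  let ?A = "twisted_algebra (Suc k)" and ?F = "(\<lambda>i. vertex_tuple i id) ` {..<Suc k}"
  have "(\<lambda>i. Vertex i w) ` {..<k} \<subseteq> points (Suc k)"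
    using w_in_X by auto
  then have "card ((\<lambda>i. Vertex i w) ` {..<k}) \<le> card (points (Suc k))"
    by (rule card_mono[OF finite_points])
  then have "k \<le> card (carrier ?A)"
    by (simp add: twisted_algebra_def card_image inj_on_def)
  also have "\<dots> \<le> card (carrier ?A) ^ card X"
    using card_X_pos by (cases "card (carrier ?A)") (auto intro: self_le_power)
  finally have "\<forall>F \<subseteq> tuples ?A X. finite F \<longrightarrow> satisfies_Sigma_on ?A X G F"
    using k ualgebra_twisted[of "Suc k"] idempotent_twisted[of "Suc k"] locally_symmetric[of _ "Suc k"]
    unfolding k_local_global_idempotent_def by (metis lessI zero_less_Suc)
  moreover have "?F \<subseteq> tuples ?A X"
    by (auto simp: tuples_def twisted_algebra_def vertex_tuple_def)
  ultimately show False using not_globally_symmetric[of "Suc k"] by blast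
qed

end

section \<open>The four families of groups\<close>

lemma rotation_apply:
  assumes "a \<in> {1..m}"
  shows "rotation m a = (if a = m then 1 else Suc a)"
proof -
  have "map (rotation m) [1..<Suc m] = rotate1 [1..<Suc m]"
    using cyclic_rotation[of "[1..<Suc m]" 1] by (simp add: rotation_def)
  then have "map (rotation m) [1..<Suc m] ! (a - 1) = rotate1 [1..<Suc m] ! (a - 1)" by simp
  then show ?thesis using assms by (auto simp: nth_rotate1 simp del: upt_Suc)
qed

lemma rotation_outside: "a \<notin> {1..m} \<Longrightarrow> rotation m a = a"
  using rotation_permutes by (rule permutes_not_in)

lemma rotation_cong:
  assumes "a \<in> {1..m}"
  shows "[int (rotation m a) = int a + 1] (mod int m)"
  using assms by (auto simp: rotation_apply cong_iff_dvd_diff)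

lemma rotation_permutes_Suc: "rotation m permutes {1..Suc m}"
  by (rule permutes_subset[OF rotation_permutes]) auto

text \<open>
  The rotation of \<open>{1..n - 1}\<close> is an \<open>(n-1)\<close>-cycle that fixes \<open>n\<close>.
\<close>

lemma sym_group_not_local_global:
  assumes "n \<ge> 3"
  shows "\<not> local_global_idempotent TYPE(nat) {1..n} (carrier (sym_group n))"
proof -
  obtain m where m: "n = Suc m" "m \<ge> 2" using assms by (cases n) auto
  interpret unique_fixed_point "{1..n}" "carrier (sym_group n)" "rotation m" n int "int m"
  proof
    show "\<exists>h\<in>carrier (sym_group n). h n \<noteq> n"
      using m by (intro bexI[of _ "transpose 1 n"]) (auto simp: sym_group_carrier permutes_swap_id)
    show "[int (rotation m a) = int a + 1] (mod int m)" if "a \<in> {1..n}" "a \<noteq> n" for a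
      using that m by (intro rotation_cong) auto
  qed (use m rotation_permutes_Suc[of m] in 
        \<open>auto simp: sym_group_carrier permutes_id rotation_outside cong_iff_dvd_diff\<close>)
  show ?thesis by (rule not_local_global_idempotent)
qed

text \<open>
  For \<open>n = 2m + 1\<close> the reflection fixes \<open>m + 1\<close> and swaps the points below with those above, so
  \<open>N = 2\<close> works.
\<close>

lemma dihedral_not_local_global:
  assumes "n > 1" "odd n"
  shows "\<not> local_global_idempotent TYPE(nat) {1..n} (dihedral n)"
proof -
  obtain m where m: "n = 2 * m + 1" "m \<ge> 1" using assms by (auto elim!: oddE)
  have gens: "reflection n \<in> dihedral n" "rotation n \<in> dihedral n"
    unfolding dihedral_def by (auto intro: generate.incl)
  interpret unique_fixed_point "{1..n}" "dihedral n" "reflection n" "Suc m"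
    "\<lambda>a. if a \<le> m then 0 else 1" 2
  proof
    show "h permutes {1..n}" if "h \<in> dihedral n" for h
      using subgroup.mem_carrier[OF dihedral_subgroup that] by (simp add: sym_group_carrier)
    show "id \<in> dihedral n"
      using subgroup.one_closed[OF dihedral_subgroup] by (simp add: sym_group_one)
    show "\<exists>h\<in>dihedral n. h (Suc m) \<noteq> Suc m"
      using gens m by (intro bexI[of _ "rotation n"]) (auto simp: rotation_apply)
  qed (use gens m in \<open>auto simp: reflection_def cong_def\<close>)
  show ?thesis by (rule not_local_global_idempotent)
qed

text \<open>
  An \<open>(n-1)\<close>-cycle may be odd, but its square is even. For even \<open>n\<close> the square is again an
  \<open>(n-1)\<close>-cycle, for odd \<open>n\<close> it consists of two cycles of length \<open>(n-1)/2 \<ge> 2\<close>.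
\<close>

lemma alt_group_not_local_global:
  assumes "n \<ge> 4"
  shows "\<not> local_global_idempotent TYPE(nat) {1..n} (carrier (alt_group n))"
proof -
  obtain m where m: "n = Suc m" "m \<ge> 3" using assms by (cases n) auto
  let ?\<gamma> = "rotation m \<circ> rotation m"
  have \<gamma>: "?\<gamma> \<in> carrier (alt_group n)"
    using m rotation_permutes_Suc[of m]
      permutes_imp_permutation[OF finite_atLeastAtMost rotation_permutes_Suc[of m]]
    by (simp add: alt_group_carrier permutes_compose evenperm_comp)
  have w: "?\<gamma> n = n" using m by (simp add: rotation_outside)
  let ?g = "transpose 1 n \<circ> transpose 2 3"
  have g: "?g \<in> carrier (alt_group n)" "?g n \<noteq> n"
    using m by (auto simp: alt_group_carrier permutes_compose permutes_swap_id evenperm_comp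
        permutation_swap_id evenperm_swap transpose_def)
  have id: "id \<in> carrier (alt_group n)" by (simp add: alt_group_carrier permutes_id evenperm_id)
  show ?thesis
  proof (cases "even m")
    case True
    then obtain j where j: "m = 2 * j" by (rule evenE)
    \<comment> \<open>Halving numbers both cycles, the even and the odd points, consecutively modulo \<open>j\<close>.\<close>
    have "int (?\<gamma> a div 2) = int (a div 2) + 1 \<or> int (?\<gamma> a div 2) = int (a div 2) + 1 - int j" 
      if "a \<in> {1..m}" for a
      using that m j by (auto simp: rotation_apply)
    then have shift: "[int (?\<gamma> a div 2) = int (a div 2) + 1] (mod int j)" if "a \<in> {1..m}" for a
      using that by (fastforce simp: cong_iff_dvd_diff)
    interpret unique_fixed_point "{1..n}" "carrier (alt_group n)" ?\<gamma> n "\<lambda>a. int (a div 2)" "int j"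
    proof
      show "\<exists>h\<in>carrier (alt_group n). h n \<noteq> n" using g by blast
      show "[int (?\<gamma> a div 2) = int (a div 2) + 1] (mod int j)" if "a \<in> {1..n}" "a \<noteq> n" for a
        using that m by (intro shift) auto
    qed (use m j \<gamma> w id in \<open>auto simp: alt_group_carrier cong_iff_dvd_diff\<close>)
    show ?thesis by (rule not_local_global_idempotent)
  next
    case False
    then obtain j where j: "m = 2 * j + 1" by (rule oddE)
    \<comment> \<open>The square shifts by 2, and \<open>j + 1\<close> is the inverse of 2 modulo \<open>m = 2j + 1\<close>.\<close>
    have shift: "[(int j + 1) * int (?\<gamma> a) = (int j + 1) * int a + 1] (mod int m)" 
      if "a \<in> {1..m}" for a
    proof -
      have "rotation m a \<in> {1..m}" using that permutes_in_image[OF rotation_permutes] by blast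
      then have "[int (?\<gamma> a) = int (rotation m a) + 1] (mod int m)"
        by (simp add: rotation_cong)
      also have "[int (rotation m a) + 1 = int a + 1 + 1] (mod int m)"
        by (intro cong_add rotation_cong that) simp
      finally have "[(int j + 1) * int (?\<gamma> a) = (int j + 1) * (int a + 1 + 1)] (mod int m)"
        by (intro cong_mult) auto
      also have "(int j + 1) * (int a + 1 + 1) = ((int j + 1) * int a + 1) + int m"
        by (simp add: j algebra_simps)
      also have "[((int j + 1) * int a + 1) + int m = (int j + 1) * int a + 1] (mod int m)"
        by (simp add: cong_def)
      finally show ?thesis .
    qed
    interpret unique_fixed_point "{1..n}" "carrier (alt_group n)" ?\<gamma> n
      "\<lambda>a. (int j + 1) * int a" "int m"
    proof
      show "\<exists>h\<in>carrier (alt_group n). h n \<noteq> n" using g by blast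
      show "[(int j + 1) * int (?\<gamma> a) = (int j + 1) * int a + 1] (mod int m)"
        if "a \<in> {1..n}" "a \<noteq> n" for a
        using that m by (intro shift) auto
    qed (use m \<gamma> w id in \<open>auto simp: alt_group_carrier cong_iff_dvd_diff\<close>)
    show ?thesis by (rule not_local_global_idempotent)
  qed
qed

text \<open>
  The \<open>n\<close>-cycles act on the whole first block and on all but the last point of the second. That point
  is moved within the second block, so the group has no fixed point although it is intransitive.
\<close>

lemma block_symmetric_not_local_global:
  assumes "n \<ge> 2"
  shows "\<not> local_global_idempotent TYPE(nat) ({1..n} <+> {1..n + 1}) (block_symmetric n (n + 1))"
proof -
  have block: "map_sum p q \<in> block_symmetric n (n + 1)" 
    if "p permutes {1..n}" "q permutes {1..n + 1}" for p q
    using that by (auto simp: block_symmetric_def DirProd_def sym_group_carrier)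
  interpret unique_fixed_point "{1..n} <+> {1..n + 1}" "block_symmetric n (n + 1)"
    "map_sum (rotation n) (rotation n)" "Inr (n + 1)" "case_sum int int" "int n"
  proof
    show "h permutes {1..n} <+> {1..n + 1}" if "h \<in> block_symmetric n (n + 1)" for h
      using that by (rule block_symmetric_permutes)
    show "id \<in> block_symmetric n (n + 1)"
      using block[of id id] by (simp add: permutes_id sum.map_id0)
    show "map_sum (rotation n) (rotation n) \<in> block_symmetric n (n + 1)"
      using rotation_permutes_Suc[of n] by (intro block rotation_permutes) simp
    show "\<exists>h\<in>block_symmetric n (n + 1). h (Inr (n + 1)) \<noteq> Inr (n + 1)"
      using assms by (intro bexI[of _ "map_sum id (transpose 1 (n + 1))"] block)
        (auto simp: permutes_id permutes_swap_id)
    show "[case_sum int int (map_sum (rotation n) (rotation n) a) = case_sum int int a + 1] (mod int n)"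
      if "a \<in> {1..n} <+> {1..n + 1}" "a \<noteq> Inr (n + 1)" for a
      using that by (auto intro!: rotation_cong)
  qed (use assms in \<open>auto simp: rotation_outside card_Plus cong_iff_dvd_diff\<close>)
  show ?thesis by (rule not_local_global_idempotent)
qed

theorem corollary18:
  "(\<forall>n \<ge> 3. \<not> local_global_idempotent TYPE(nat) {1..n} (carrier (sym_group n))) \<and>
   (\<forall>n > 1. odd n \<longrightarrow> \<not> local_global_idempotent TYPE(nat) {1..n} (dihedral n)) \<and>
   (\<forall>n \<ge> 4. \<not> local_global_idempotent TYPE(nat) {1..n} (carrier (alt_group n))) \<and>
   (\<forall>n \<ge> 2. \<not> local_global_idempotent TYPE(nat) ({1..n} <+> {1..n + 1})
               (block_symmetric n (n + 1)))"
  using sym_group_not_local_global dihedral_not_local_global alt_group_not_local_global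
    block_symmetric_not_local_global by blast

end
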